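(* For $m,n\ge1$ let $p(m,n)$ be the number of Fibonacci polyominoes with horizontal semiperimeter $m$ and vertical semiperimeter $n$, and let $P(x,y)=\sum_{m,n\geq 1}p(m,n)x^my^n$. Then, as formal power series, \[ P(x,y)=\frac{1 + x - y - 3 x y -(1+x)\sqrt{(1 - y) (1 - y - 4 x y)}}{2x}, \] where the square root denotes the branch (power series) with constant term $1$.
   Context: A Fibonacci polyomino is a (nonempty) polyomino, considered up to translation, that is column-convex (each column is a contiguous segment of unit cells) and such that, reading columns from left to right, the bottom cell of each column lies exactly one unit above the bottom cell of the preceding column. Equivalently, it is given by a sequence of column heights $(h_1,\dots,h_m)$, $m\ge 1$, with $h_i\ge 2$ for $1\le i\le m-1$ and $h_m\ge 1$; column $i$ consists of the cells in column position $i$ and rows $i,i+1,\dots,i+h_i-1$. The horizontal (resp. vertical) semiperimeter of a polyomino is half the number of horizontal (resp. vertical) unit edges on its boundary (a boundary edge is a unit edge belonging to exactly one cell). *)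

theory Defs
  imports "HOL-Computational_Algebra.Formal_Power_Series"
begin

unbundle fps_syntax

text \<open>
  The unit cell with column position \<open>i\<close> and row \<open>j\<close> is the pair \<open>(i, j)\<close>, occupying the
  square \<open>[i, i + 1] \<times> [j, j + 1]\<close> of the plane.
\<close>

type_synonym cell = "int \<times> int"

definition adjacent :: "cell \<Rightarrow> cell \<Rightarrow> bool" where
  "adjacent c d \<longleftrightarrow> \<bar>fst c - fst d\<bar> + \<bar>snd c - snd d\<bar> = 1"

definition polyomino :: "cell set \<Rightarrow> bool" where
  "polyomino A \<longleftrightarrow> finite A \<and> A \<noteq> {} \<and>
     (\<forall>c\<in>A. \<forall>d\<in>A. (c, d) \<in> {(a, b). a \<in> A \<and> b \<in> A \<and> adjacent a b}\<^sup>*)"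

definition column :: "cell set \<Rightarrow> int \<Rightarrow> int set" where
  "column A i = {j. (i, j) \<in> A}"

definition column_convex :: "cell set \<Rightarrow> bool" where
  "column_convex A \<longleftrightarrow> (\<forall>i. \<exists>a b. column A i = {a..b})"

text \<open>
  The nonempty columns of a polyomino occupy consecutive positions, so the column preceding
  column \<open>i + 1\<close> is column \<open>i\<close>.
\<close>

definition fibonacci_polyomino :: "cell set \<Rightarrow> bool" where
  "fibonacci_polyomino A \<longleftrightarrow> polyomino A \<and> column_convex A \<and>
     (\<forall>i. column A i \<noteq> {} \<and> column A (i + 1) \<noteq> {} \<longrightarrow>
        Min (column A (i + 1)) = Min (column A i) + 1)"

definition translation_rel :: "(cell set \<times> cell set) set" where
  "translation_rel = {(A, B). \<exists>u v. B = (\<lambda>(i, j). (i + u, j + v)) ` A}"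

text \<open>
  A unit edge is represented by its left end point if it is horizontal, and by its lower end
  point if it is vertical.
\<close>

definition hor_edges :: "cell \<Rightarrow> (int \<times> int) set" where
  "hor_edges c = {(fst c, snd c), (fst c, snd c + 1)}"

definition ver_edges :: "cell \<Rightarrow> (int \<times> int) set" where
  "ver_edges c = {(fst c, snd c), (fst c + 1, snd c)}"

definition hor_boundary :: "cell set \<Rightarrow> (int \<times> int) set" where
  "hor_boundary A = {e. \<exists>!c. c \<in> A \<and> e \<in> hor_edges c}"

definition ver_boundary :: "cell set \<Rightarrow> (int \<times> int) set" where
  "ver_boundary A = {e. \<exists>!c. c \<in> A \<and> e \<in> ver_edges c}"

definition hor_semiperimeter :: "cell set \<Rightarrow> rat" where
  "hor_semiperimeter A = of_nat (card (hor_boundary A)) / 2"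

definition ver_semiperimeter :: "cell set \<Rightarrow> rat" where
  "ver_semiperimeter A = of_nat (card (ver_boundary A)) / 2"

definition fib_count :: "nat \<Rightarrow> nat \<Rightarrow> nat" where
  "fib_count m n = card ({A. fibonacci_polyomino A \<and>
     hor_semiperimeter A = of_nat m \<and> ver_semiperimeter A = of_nat n} // translation_rel)"

text \<open>
  Power series in \<open>x\<close> and \<open>y\<close> are power series in \<open>x\<close> whose coefficients are power series
  in \<open>y\<close>; the coefficient of \<open>x\<^sup>m y\<^sup>n\<close> in \<open>F\<close> is \<open>F $ m $ n\<close>.
\<close>

type_synonym fps2 = "rat fps fps"

abbreviation var_x :: fps2 where "var_x \<equiv> fps_X"

abbreviation var_y :: fps2 where "var_y \<equiv> fps_const fps_X"

definition fib_gf :: fps2 where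
  "fib_gf = Abs_fps (\<lambda>m. Abs_fps (\<lambda>n. if 1 \<le> m \<and> 1 \<le> n then of_nat (fib_count m n) else 0))"

definition fps2_sqrt :: "fps2 \<Rightarrow> fps2" where
  "fps2_sqrt F = (THE S. S\<^sup>2 = F \<and> S $ 0 $ 0 = 1)"

text \<open>The description in the definition above is proper whenever \<open>F\<close> has constant term 1.\<close>

fun sqrt_coeff :: "'a::comm_ring_1 fps \<Rightarrow> 'a \<Rightarrow> 'a \<Rightarrow> nat \<Rightarrow> 'a" where
  "sqrt_coeff f s u n =
     (if n = 0 then s
      else u * (f $ n - (\<Sum>i\<in>{1..<n}. sqrt_coeff f s u i * sqrt_coeff f s u (n - i))))"

declare sqrt_coeff.simps [simp del]

lemma fps_square_root_exists:
  fixes f :: "'a::comm_ring_1 fps"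
  assumes s: "s\<^sup>2 = f $ 0" and u: "2 * s * u = 1"
  shows "\<exists>S. S\<^sup>2 = f \<and> S $ 0 = s"
proof (intro exI conjI)
  let ?c = "sqrt_coeff f s u"
  show "Abs_fps ?c $ 0 = s"
    by (simp add: sqrt_coeff.simps)
  show "(Abs_fps ?c)\<^sup>2 = f"
  proof (rule fps_ext)
    fix n
    show "(Abs_fps ?c)\<^sup>2 $ n = f $ n"
    proof (cases "n = 0")
      case True
      then show ?thesis
        using s by (simp add: fps_square_nth sqrt_coeff.simps power2_eq_square)
    next
      case False
      then have set: "{..n} = insert 0 (insert n {1..<n})"
        by auto
      have c0: "?c 0 = s"
        by (simp add: sqrt_coeff.simps)
      have "(Abs_fps ?c)\<^sup>2 $ n = (\<Sum>i\<in>{1..<n}. ?c i * ?c (n - i)) + 2 * s * ?c n"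
        using False by (simp add: fps_square_nth set c0 algebra_simps)
      also have "2 * s * ?c n = (2 * s * u) * (f $ n - (\<Sum>i\<in>{1..<n}. ?c i * ?c (n - i)))"
        using False by (subst sqrt_coeff.simps) (simp add: mult.assoc)
      finally show ?thesis
        unfolding u by simp
    qed
  qed
qed

lemma fps2_sqrt_ex1:
  fixes F :: fps2
  assumes "F $ 0 $ 0 = 1"
  shows "\<exists>!S. S\<^sup>2 = F \<and> S $ 0 $ 0 = 1"
proof -
  have "\<exists>s. s\<^sup>2 = F $ 0 \<and> s $ 0 = 1"
    by (rule fps_square_root_exists[where u = "1 / 2"]) (use assms in simp_all)
  then obtain s where s: "s\<^sup>2 = F $ 0" "s $ 0 = 1"
    by blast
  have "2 * s * (fps_const (1 / 2) * inverse s) = (2 * fps_const (1 / 2)) * (inverse s * s)"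
    by (simp add: algebra_simps)
  also have "2 * fps_const (1 / 2) = (1 :: rat fps)"
    by (simp add: fps_eq_iff fps_numeral_fps_const flip: fps_const_mult)
  also have "inverse s * s = 1"
    using s by (simp add: inverse_mult_eq_1)
  finally have "2 * s * (fps_const (1 / 2) * inverse s) = 1"
    by simp
  from fps_square_root_exists[OF s(1) this] obtain S where S: "S\<^sup>2 = F" "S $ 0 = s"
    by blast
  show ?thesis
  proof (rule ex1I[of _ S])
    show "S\<^sup>2 = F \<and> S $ 0 $ 0 = 1"
      using S s by simp
  next
    fix T
    assume T: "T\<^sup>2 = F \<and> T $ 0 $ 0 = 1"
    then have "T\<^sup>2 = S\<^sup>2"
      using S by simp
    then have "T = S \<or> T = - S"
      by (simp only: power2_eq_iff)
    then show "T = S"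
      using T S s by auto
  qed
qed

lemma fps2_sqrt:
  assumes "F $ 0 $ 0 = 1"
  shows "(fps2_sqrt F)\<^sup>2 = F" and "fps2_sqrt F $ 0 $ 0 = 1"
  using theI'[OF fps2_sqrt_ex1[OF assms]] by (simp_all add: fps2_sqrt_def)

text \<open>Dividing a multiple of \<open>2 x\<close> by \<open>2 x\<close> gives the genuine quotient.\<close>

lemma fps2_divide_2x: "2 * var_x * Q / (2 * var_x) = Q"
proof -
  let ?g = "fps_const (fps_const 2) * var_x"
  have t: "2 * var_x = ?g"
    by (simp add: numeral_fps_const)
  have sd: "subdegree ?g = 1"
    by (subst subdegree_mult) auto
  have uf: "unit_factor ?g = fps_const (fps_const 2)"
    unfolding fps_unit_factor_def sd by (simp add: fps_eq_iff)
  have i: "inverse (fps_const (fps_const 2)) = (fps_const (fps_const (1 / 2)) :: fps2)"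
    by (simp add: fps_const_inverse)
  have "?g * Q * fps_const (fps_const (1 / 2)) = var_x * Q"
    by (simp add: fps_eq_iff mult.assoc)
  then show ?thesis
    unfolding t fps_divide_def sd uf i by (simp add: fps_shift_times_fps_X fps_eq_iff)
qed

end

theory Submission
  imports Defs
begin

text \<open>
  Up to translation a Fibonacci polyomino is its list of column heights. The horizontal
  semiperimeter is the number of columns. Putting a column of height \<open>k\<close> in front of one of
  height \<open>j\<close> raises the vertical semiperimeter by \<open>max (k - j) 1\<close>, so that the generating
  function \<open>g k\<close> of the polyominoes with first height \<open>k\<close> satisfies, for \<open>k \<ge> 2\<close>,
  \<open>g k = x y\<^sup>k + x (\<Sum>j. g j y\<^bsup>max (k - j) 1\<^esup>)\<close>, while \<open>g 1 = x y\<close>.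

  This system determines the coefficients of \<open>g\<close> by induction on the power of \<open>x\<close>, and its solution
  is geometric: \<open>g k = e (1 - b) b\<^bsup>k - 2\<^esup>\<close> for \<open>k \<ge> 2\<close>, where the ratio \<open>b\<close> is the root without
  constant term of the kernel equation \<open>(1 - b) (b - y) = x y (1 - y)\<close>, whose discriminant is
  \<open>(1 - y) (1 - y - 4 x y)\<close>. The total is \<open>x y + e\<close>, with \<open>e\<close> obtained from the equation
  for \<open>k = 2\<close>.
\<close>

subsection \<open>Column heights\<close>

fun fib_heights :: "nat list \<Rightarrow> bool" where
  "fib_heights [] = False"
| "fib_heights [h] = (1 \<le> h)"
| "fib_heights (h # h' # hs) = (2 \<le> h \<and> fib_heights (h' # hs))"

text \<open>The subtraction is truncated, which does no harm under \<open>max _ 1\<close>.\<close>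

fun ver_semi :: "nat list \<Rightarrow> nat" where
  "ver_semi [] = 0"
| "ver_semi [h] = h"
| "ver_semi (h # h' # hs) = max (h - h') 1 + ver_semi (h' # hs)"

fun stair :: "int \<Rightarrow> int \<Rightarrow> nat list \<Rightarrow> cell set" where
  "stair a c [] = {}"
| "stair a c (h # hs) = {a} \<times> {c..<c + int h} \<union> stair (a + 1) (c + 1) hs"

lemma fib_heights_hd_pos: "fib_heights (h # hs) \<Longrightarrow> 1 \<le> h"
  by (cases hs) auto

lemma fib_heights_tl: "fib_heights (h # hs) \<Longrightarrow> hs \<noteq> [] \<Longrightarrow> fib_heights hs"
  by (cases hs) auto

lemma hd_le_ver_semi: "hd hs \<le> ver_semi hs" if "hs \<noteq> []"
  using that by (induction hs rule: ver_semi.induct) auto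

lemma stair_fst_ge: "p \<in> stair a c hs \<Longrightarrow> a \<le> fst p"
  by (induction hs arbitrary: a c) force+

lemma stair_notin_left: "i < a \<Longrightarrow> (i, j) \<notin> stair a c hs"
  using stair_fst_ge[of "(i, j)" a c hs] by auto

lemma finite_stair: "finite (stair a c hs)"
  by (induction hs arbitrary: a c) auto

text \<open>The remaining columns lie strictly to the right of \<open>a\<close>, so the union is a
  case distinction on \<open>i\<close>. This form replaces the union as the way to unfold a
  staircase.\<close>

lemma stair_Cons_iff:
  "(i, j) \<in> stair a c (h # hs) \<longleftrightarrow>
     (if i = a then c \<le> j \<and> j < c + int h else (i, j) \<in> stair (a + 1) (c + 1) hs)"
  using stair_notin_left[of a "a + 1" j "c + 1" hs] by auto

declare stair.simps(2) [simp del]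

lemma column_stair_Cons:
  "column (stair a c (h # hs)) i =
     (if i = a then {c..<c + int h} else column (stair (a + 1) (c + 1) hs) i)"
  by (auto simp: column_def stair_Cons_iff)

lemma translate_stair:
  "(\<lambda>(i, j). (i + u, j + v)) ` stair a c hs = stair (a + u) (c + v) hs"
proof (induction hs arbitrary: a c)
  case (Cons h hs)
  have "(\<lambda>(i, j). (i + u, j + v)) ` ({a} \<times> {c..<c + int h}) = {a + u} \<times> {c + v..<c + v + int h}"
  proof (intro equalityI subsetI)
    fix p assume "p \<in> {a + u} \<times> {c + v..<c + v + int h}"
    then show "p \<in> (\<lambda>(i, j). (i + u, j + v)) ` ({a} \<times> {c..<c + int h})"
      by (intro image_eqI[of _ _ "(a, snd p - v)"]) auto
  qed auto
  then show ?case
    by (simp add: stair.simps(2) image_Un Cons.IH algebra_simps)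
qed simp

text \<open>The corner column is the least first coordinate, the nonempty interval found there
  determines \<open>c\<close> and the first height, and removing it leaves equal staircases of the
  tails.\<close>

lemma stair_inject:
  assumes "fib_heights hs" "fib_heights hs'" "stair a c hs = stair a' c' hs'"
  shows "hs = hs' \<and> a = a' \<and> c = c'"
  using assms
proof (induction hs arbitrary: a c a' c' hs')
  case (Cons h hs)
  obtain k ks where hs': "hs' = k # ks"
    using Cons.prems by (cases hs') auto
  have pos: "1 \<le> h" "1 \<le> k"
    using Cons.prems fib_heights_hd_pos unfolding hs' by blast+
  have eq: "(i, j) \<in> stair a c (h # hs) \<longleftrightarrow> (i, j) \<in> stair a' c' (k # ks)" for i j
    using Cons.prems hs' by simp
  have "a' \<le> a"
    using eq[of a c] pos stair_fst_ge[of "(a, c)" a' c' hs'] hs' by (auto simp: stair_Cons_iff)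
  moreover have "a \<le> a'"
    using eq[of a' c'] pos stair_fst_ge[of "(a', c')" a c "h # hs"] hs' by (auto simp: stair_Cons_iff)
  ultimately have a: "a = a'" by simp
  have col: "{c..<c + int h} = {c'..<c' + int k}"
    using eq[of a] a by (simp add: stair_Cons_iff set_eq_iff)
  then have c: "c = c'" and h: "h = k"
    using pos atLeastLessThan_eq_iff[of c "c + int h" c' "c' + int k"] by auto
  have "(i, j) \<in> stair (a + 1) (c + 1) hs \<longleftrightarrow> (i, j) \<in> stair (a + 1) (c + 1) ks" for i j
  proof (cases "i = a")
    case True
    then show ?thesis by (simp add: stair_notin_left)
  next
    case False
    then show ?thesis using eq[of i j] a c by (simp add: stair_Cons_iff)
  qed
  then have rest: "stair (a + 1) (c + 1) hs = stair (a + 1) (c + 1) ks"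
    by auto
  have ne: "stair i j ls \<noteq> {}" if "fib_heights ls" for i j ls
    using that fib_heights_hd_pos by (cases ls) (force simp: stair.simps(2))+
  \<comment> \<open>The induction hypothesis speaks of nonempty tails only, as
    \<open>fib_heights []\<close> is false; an empty tail is recognised by its empty
    staircase.\<close>
  have "hs = ks"
  proof (cases "hs = [] \<or> ks = []")
    case True
    have "hs = [] \<longleftrightarrow> ks = []"
      using rest ne[of hs] ne[of ks] Cons.prems hs' fib_heights_tl by (metis stair.simps(1))
    with True show ?thesis by blast
  next
    case False
    then show ?thesis
      using Cons.IH[OF _ _ rest] Cons.prems hs' fib_heights_tl by blast
  qed
  then show ?case
    using a c h hs' by simp
qed simp

subsection \<open>Semiperimeters\<close>

lemma ex1_doubleton_iff: "p \<noteq> q \<Longrightarrow> (\<exists>!c. c \<in> A \<and> (c = p \<or> c = q)) \<longleftrightarrow> (p \<in> A) \<noteq> (q \<in> A)"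
  by metis

text \<open>Only the cells above and below the edge contain it, so lying on exactly one cell is an
  exclusive or.\<close>

lemma hor_boundary_iff: "(i, j) \<in> hor_boundary A \<longleftrightarrow> ((i, j) \<in> A) \<noteq> ((i, j - 1) \<in> A)"
proof -
  have "c \<in> A \<and> (i, j) \<in> hor_edges c \<longleftrightarrow> c \<in> A \<and> (c = (i, j) \<or> c = (i, j - 1))" for c
    by (cases c) (auto simp: hor_edges_def)
  then show ?thesis
    by (simp add: hor_boundary_def ex1_doubleton_iff)
qed

lemma ver_boundary_iff: "(i, j) \<in> ver_boundary A \<longleftrightarrow> ((i, j) \<in> A) \<noteq> ((i - 1, j) \<in> A)"
proof -
  have "c \<in> A \<and> (i, j) \<in> ver_edges c \<longleftrightarrow> c \<in> A \<and> (c = (i, j) \<or> c = (i - 1, j))" for c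
    by (cases c) (auto simp: ver_edges_def)
  then show ?thesis
    by (simp add: ver_boundary_def ex1_doubleton_iff)
qed

text \<open>Horizontal edges of different columns do not interact: each column contributes its
  bottom edge and its top edge.\<close>

lemma card_hor_boundary_stair:
  "fib_heights hs \<Longrightarrow> finite (hor_boundary (stair a c hs)) \<and>
     card (hor_boundary (stair a c hs)) = 2 * length hs"
proof (induction hs arbitrary: a c)
  case (Cons h hs)
  let ?R = "hor_boundary (stair (a + 1) (c + 1) hs)"
  have h: "1 \<le> h"
    using Cons.prems by (rule fib_heights_hd_pos)
  have eq: "hor_boundary (stair a c (h # hs)) = {(a, c), (a, c + int h)} \<union> ?R"
  proof (rule set_eqI)
    fix p :: cell
    obtain i j where "p = (i, j)" by (cases p)
    then show "p \<in> hor_boundary (stair a c (h # hs)) \<longleftrightarrow> p \<in> {(a, c), (a, c + int h)} \<union> ?R"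
      using h stair_notin_left[of a "a + 1" _ "c + 1" hs]
      by (auto simp: hor_boundary_iff stair_Cons_iff)
  qed
  have R: "finite ?R \<and> card ?R = 2 * length hs"
  proof (cases "hs = []")
    case True
    then have "?R = {}"
      by (auto simp: hor_boundary_iff)
    with True show ?thesis by simp
  next
    case False
    then show ?thesis
      using Cons fib_heights_tl by blast
  qed
  have "(a, j) \<notin> ?R" for j
    using stair_notin_left[of a "a + 1" _ "c + 1" hs] by (simp add: hor_boundary_iff)
  with R h show ?case
    unfolding eq by simp
qed simp

lemma hor_semiperimeter_stair:
  "fib_heights hs \<Longrightarrow> hor_semiperimeter (stair a c hs) = of_nat (length hs)"
  by (simp add: hor_semiperimeter_def card_hor_boundary_stair)

text \<open>Leaving out the leftmost vertical line makes the boundary of a staircase additive when a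
  column is put in front.\<close>

definition inner_ver_boundary :: "int \<Rightarrow> cell set \<Rightarrow> (int \<times> int) set" where
  "inner_ver_boundary a A = {p \<in> ver_boundary A. a < fst p}"

lemma inner_ver_boundary_iff:
  "(i, j) \<in> inner_ver_boundary a A \<longleftrightarrow> a < i \<and> ((i, j) \<in> A) \<noteq> ((i - 1, j) \<in> A)"
  by (auto simp: inner_ver_boundary_def ver_boundary_iff)

text \<open>The summand \<open>hd hs\<close> stands for the omitted leftmost line. A new front
  column leaves the inner boundary of the tail intact and adds the line \<open>a + 1\<close>, which
  carries the symmetric difference of the two adjacent columns.\<close>

lemma card_inner_ver_boundary_stair:
  "fib_heights hs \<Longrightarrow> finite (inner_ver_boundary a (stair a c hs)) \<and>
     hd hs + card (inner_ver_boundary a (stair a c hs)) = 2 * ver_semi hs"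
proof (induction hs arbitrary: a c rule: ver_semi.induct)
  case (2 h)
  have "inner_ver_boundary a (stair a c [h]) = {a + 1} \<times> {c..<c + int h}"
    by (auto simp: inner_ver_boundary_iff stair_Cons_iff split: if_splits)
  then show ?case by simp
next
  case (3 h h' hs)
  let ?W = "inner_ver_boundary (a + 1) (stair (a + 1) (c + 1) (h' # hs))"
  let ?C = "{c..<c + int h}" and ?C' = "{c + 1..<c + 1 + int h'}"
  let ?D = "(?C - ?C') \<union> (?C' - ?C)"
  have h: "2 \<le> h" and hs: "fib_heights (h' # hs)" "1 \<le> h'"
    using 3 fib_heights_hd_pos by auto
  have IH: "finite ?W" "h' + card ?W = 2 * ver_semi (h' # hs)"
    using "3.IH"[OF hs(1), of "a + 1" "c + 1"] by auto
  have eq: "inner_ver_boundary a (stair a c (h # h' # hs)) = ({a + 1} \<times> ?D) \<union> ?W"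
  proof (rule set_eqI)
    fix p :: cell
    obtain i j where p: "p = (i, j)" by (cases p)
    consider "i \<le> a" | "i = a + 1" | "a + 1 < i" by linarith
    then show "p \<in> inner_ver_boundary a (stair a c (h # h' # hs)) \<longleftrightarrow> p \<in> ({a + 1} \<times> ?D) \<union> ?W"
      unfolding p by cases (auto simp: inner_ver_boundary_iff stair_Cons_iff)
  qed
  \<comment> \<open>The bottoms differ by one, giving the single edge \<open>c\<close>; the tops
    differ by the distance between \<open>h\<close> and \<open>h' + 1\<close>.\<close>
  have D: "h + card ?D = h' + 2 * max (h - h') 1"
  proof (cases "h' + 1 \<le> h")
    case True
    then have "?D = insert c {c + 1 + int h'..<c + int h}"
      using h hs by auto
    with True show ?thesis by simp
  next
    case False
    then have "?D = insert c {c + int h..<c + 1 + int h'}"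
      using h hs by auto
    with False h show ?thesis by simp
  qed
  have "({a + 1} \<times> ?D) \<inter> ?W = {}"
    by (auto simp: inner_ver_boundary_iff)
  then have "card (({a + 1} \<times> ?D) \<union> ?W) = card ?D + card ?W"
    using IH by (subst card_Un_disjoint) (auto simp: card_cartesian_product)
  then show ?case
    using IH D unfolding eq by simp
qed simp

lemma ver_semiperimeter_stair:
  assumes "fib_heights hs"
  shows "ver_semiperimeter (stair a c hs) = of_nat (ver_semi hs)"
proof -
  obtain h hs' where hs: "hs = h # hs'"
    using assms by (cases hs) auto
  let ?W = "inner_ver_boundary a (stair a c hs)"
  have eq: "ver_boundary (stair a c hs) = ({a} \<times> {c..<c + int h}) \<union> ?W"
  proof (rule set_eqI)
    fix p :: cell
    obtain i j where p: "p = (i, j)" by (cases p)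
    consider "i < a" | "i = a" | "a < i" by linarith
    then show "p \<in> ver_boundary (stair a c hs) \<longleftrightarrow> p \<in> ({a} \<times> {c..<c + int h}) \<union> ?W"
      using stair_notin_left[of _ a j c hs]
      unfolding p by cases (auto simp: inner_ver_boundary_iff ver_boundary_iff hs stair_Cons_iff)
  qed
  have W: "finite ?W" "h + card ?W = 2 * ver_semi hs"
    using card_inner_ver_boundary_stair[OF assms, of a c] hs by auto
  have "({a} \<times> {c..<c + int h}) \<inter> ?W = {}"
    by (auto simp: inner_ver_boundary_iff)
  then have "card (ver_boundary (stair a c hs)) = 2 * ver_semi hs"
    using W unfolding eq by (subst card_Un_disjoint) (auto simp: card_cartesian_product)
  then show ?thesis
    by (simp add: ver_semiperimeter_def)
qed

subsection \<open>Fibonacci polyominoes are the staircases of height lists\<close>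

definition adj_rel :: "cell set \<Rightarrow> (cell \<times> cell) set" where
  "adj_rel A = {(p, q). p \<in> A \<and> q \<in> A \<and> adjacent p q}"

lemma adjacent_sym: "adjacent p q \<Longrightarrow> adjacent q p"
  by (auto simp: adjacent_def abs_minus_commute)

lemma sym_adj_rel: "sym ((adj_rel A)\<^sup>*)"
  by (rule sym_rtrancl) (auto simp: sym_def adj_rel_def adjacent_sym)

lemma adj_rel_mono: "A \<subseteq> B \<Longrightarrow> (adj_rel A)\<^sup>* \<subseteq> (adj_rel B)\<^sup>*"
  by (rule rtrancl_mono) (auto simp: adj_rel_def)

lemma column_connected:
  assumes "{a} \<times> {c..<c + int h} \<subseteq> A" "k < h"
  shows "((a, c), (a, c + int k)) \<in> (adj_rel A)\<^sup>*"
  using assms(2)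
proof (induction k)
  case (Suc k)
  have "(a, c + int k) \<in> A" "(a, c + int (Suc k)) \<in> A"
    using Suc.prems by (auto intro!: subsetD[OF assms(1)])
  then have "((a, c + int k), (a, c + int (Suc k))) \<in> adj_rel A"
    by (auto simp: adj_rel_def adjacent_def)
  with Suc show ?case
    by (meson Suc_lessD rtrancl.rtrancl_into_rtrancl)
qed simp

text \<open>From the corner, one step up and one step right lead to the corner of the tail. The step
  up stays inside because a column that is not the last has height at least 2.\<close>

lemma stair_connected_to_corner:
  "fib_heights hs \<Longrightarrow> p \<in> stair a c hs \<Longrightarrow> ((a, c), p) \<in> (adj_rel (stair a c hs))\<^sup>*"
proof (induction hs arbitrary: a c)
  case (Cons h hs)
  let ?A = "stair a c (h # hs)"
  have sub: "{a} \<times> {c..<c + int h} \<subseteq> ?A" "stair (a + 1) (c + 1) hs \<subseteq> ?A"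
    by (auto simp: stair.simps(2))
  show ?case
  proof (cases "p \<in> {a} \<times> {c..<c + int h}")
    case True
    then have "p = (a, c + int (nat (snd p - c)))" "nat (snd p - c) < h"
      by auto
    then show ?thesis
      using column_connected[OF sub(1)] by metis
  next
    case False
    then have p: "p \<in> stair (a + 1) (c + 1) hs"
      using Cons.prems by (simp add: stair.simps(2))
    then obtain h' hs' where hs: "hs = h' # hs'"
      by (cases hs) auto
    have h: "2 \<le> h" "1 \<le> h'"
      using Cons.prems hs fib_heights_hd_pos by auto
    have "((a, c), (a, c + int 1)) \<in> (adj_rel ?A)\<^sup>*"
      using column_connected[OF sub(1), of 1] h by simp
    moreover have "(a, c + 1) \<in> ?A" "(a + 1, c + 1) \<in> ?A"
      using h by (auto simp: stair_Cons_iff hs)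
    then have "((a, c + int 1), (a + 1, c + 1)) \<in> adj_rel ?A"
      by (auto simp: adj_rel_def adjacent_def)
    moreover have "((a + 1, c + 1), p) \<in> (adj_rel ?A)\<^sup>*"
      using Cons p hs adj_rel_mono[OF sub(2)] by (auto dest: fib_heights_tl)
    ultimately show ?thesis
      by (meson rtrancl_trans rtrancl.rtrancl_into_rtrancl)
  qed
qed simp

lemma polyomino_iff:
  "polyomino A \<longleftrightarrow> finite A \<and> A \<noteq> {} \<and> (\<forall>p\<in>A. \<forall>q\<in>A. (p, q) \<in> (adj_rel A)\<^sup>*)"
  by (simp add: polyomino_def adj_rel_def)

lemma polyomino_stair:
  assumes "fib_heights hs"
  shows "polyomino (stair a c hs)"
proof -
  have "stair a c hs \<noteq> {}"
    using assms fib_heights_hd_pos by (cases hs) (force simp: stair.simps(2))+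
  moreover have "(p, q) \<in> (adj_rel (stair a c hs))\<^sup>*"
    if "p \<in> stair a c hs" "q \<in> stair a c hs" for p q
    using that stair_connected_to_corner[OF assms] sym_adj_rel by (meson rtrancl_trans symD)
  ultimately show ?thesis
    by (simp add: polyomino_iff finite_stair)
qed

text \<open>The explicit lower end \<open>c + (i - a)\<close> yields both column convexity and the
  rise of the bottoms by one.\<close>

lemma column_stair_cases:
  "fib_heights hs \<Longrightarrow> column (stair a c hs) i = {} \<or>
     (\<exists>h\<ge>1. column (stair a c hs) i = {c + (i - a)..<c + (i - a) + int h})"
proof (induction hs arbitrary: a c)
  case (Cons h hs)
  show ?case
  proof (cases "i = a")
    case True
    then show ?thesis
      using fib_heights_hd_pos[OF Cons.prems] by (auto simp: column_stair_Cons)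
  next
    case False
    then have eq: "column (stair a c (h # hs)) i = column (stair (a + 1) (c + 1) hs) i"
      by (simp add: column_stair_Cons)
    show ?thesis
    proof (cases "hs = []")
      case True
      then show ?thesis
        unfolding eq by (simp add: column_def)
    next
      case False
      have "c + 1 + (i - (a + 1)) = c + (i - a)" by simp
      then show ?thesis
        using Cons.IH[OF fib_heights_tl[OF Cons.prems False], of "a + 1" "c + 1"]
        unfolding eq by simp
    qed
  qed
qed simp

lemma Min_int_interval: "x < y \<Longrightarrow> Min {x..<y} = (x :: int)"
  by (rule Min_eqI) auto

lemma fibonacci_polyomino_stair:
  assumes "fib_heights hs"
  shows "fibonacci_polyomino (stair a c hs)"
proof -
  have "\<exists>p q. column (stair a c hs) i = {p..q}" for i
  proof -
    \<comment> \<open>\<open>column_convex\<close> wants a closed interval for empty columns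
      too.\<close>
    have "{} = {1..0::int}" "{p..<q} = {p..q - 1}" for p q :: int
      by auto
    then show ?thesis
      using column_stair_cases[OF assms, of a c i] by metis
  qed
  moreover have "Min (column (stair a c hs) i) = c + (i - a)"
    if "column (stair a c hs) i \<noteq> {}" for i
    using column_stair_cases[OF assms, of a c i] that by (auto simp: Min_int_interval)
  ultimately show ?thesis
    using polyomino_stair[OF assms] by (auto simp: fibonacci_polyomino_def column_convex_def)
qed

text \<open>A path from \<open>p\<close> to \<open>q\<close> changes column by at most one per step,
  so some step crosses from column \<open>i\<close> to column \<open>i + 1\<close>, and that step is
  horizontal.\<close>

lemma polyomino_consecutive_columns_meet:
  assumes "polyomino A" "p \<in> A" "q \<in> A" "fst p \<le> i" "i < fst q"
  shows "\<exists>j. (i, j) \<in> A \<and> (i + 1, j) \<in> A"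
proof -
  have "(p, q) \<in> (adj_rel A)\<^sup>*"
    using assms by (auto simp: polyomino_iff)
  then show ?thesis
    using assms(5)
  proof (induction rule: rtrancl_induct)
    case base
    then show ?case using assms(4) by simp
  next
    case (step r s)
    show ?case
    proof (cases "i < fst r")
      case True
      then show ?thesis using step by blast
    next
      case False
      then have "fst r = i" "fst s = i + 1" "snd r = snd s"
        using step by (auto simp: adj_rel_def adjacent_def)
      then show ?thesis
        using step.hyps(2) unfolding adj_rel_def by (cases r; cases s) auto
    qed
  qed
qed

text \<open>Induction on the distance \<open>d\<close> to the last column. \<open>A\<close> stays
  fixed and only the left end \<open>i\<close> moves, so the truncated set need not be shown to be a
  polyomino.\<close>

lemma fibonacci_polyomino_right_part:
  assumes A: "fibonacci_polyomino A"
    and i: "p \<in> A" "fst p = i" "q \<in> A" "fst q = i + int d" "\<forall>r\<in>A. fst r \<le> i + int d"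
  shows "\<exists>hs. fib_heights hs \<and> {r \<in> A. i \<le> fst r} = stair i (Min (column A i)) hs"
  using i
proof (induction d arbitrary: i p)
  have fin: "finite (column A k)" for k
  proof -
    have "(\<lambda>j. (k, j)) ` column A k \<subseteq> A" by (auto simp: column_def)
    then show ?thesis
      using A by (meson finite_imageD finite_subset fibonacci_polyomino_def inj_onI polyomino_def prod.inject)
  qed
  have col: "\<exists>h\<ge>1. column A k = {Min (column A k)..<Min (column A k) + int h}"
    if "(k, j) \<in> A" for k j
  proof -
    obtain u v where uv: "column A k = {u..v}"
      using A unfolding fibonacci_polyomino_def column_convex_def by blast
    have "u \<le> v"
    proof -
      have "j \<in> {u..v}"
        using that uv by (auto simp: column_def)
      then show ?thesis by simp
    qed
    then have "Min (column A k) = u"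
      unfolding uv by (intro Min_eqI) auto
    then show ?thesis
      using \<open>u \<le> v\<close> unfolding uv by (intro exI[of _ "nat (v + 1 - u)"]) auto
  qed
  {
    case 0
    then have "(i, snd p) \<in> A" by auto
    then obtain h where h: "h \<ge> 1" "column A i = {Min (column A i)..<Min (column A i) + int h}"
      using col by blast
    have "{r \<in> A. i \<le> fst r} = stair i (Min (column A i)) [h]"
    proof -
      have "{r \<in> A. i \<le> fst r} = {i} \<times> column A i"
        using 0 by (force simp: column_def)
      then show ?thesis
        using h by (simp add: stair.simps(2))
    qed
    then show ?case
      using h by (intro exI[of _ "[h]"]) simp
  next
    case (Suc d)
    obtain j where j: "(i, j) \<in> A" "(i + 1, j) \<in> A"
      using polyomino_consecutive_columns_meet[of A p q i] A Suc.prems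
      by (auto simp: fibonacci_polyomino_def)
    obtain hs where hs: "fib_heights hs"
      "{r \<in> A. i + 1 \<le> fst r} = stair (i + 1) (Min (column A (i + 1))) hs"
      using Suc.IH[OF j(2), of "i + 1"] Suc.prems by (auto simp: algebra_simps)
    have Min: "Min (column A (i + 1)) = Min (column A i) + 1"
      using A j unfolding fibonacci_polyomino_def column_def by blast
    obtain h where h: "h \<ge> 1" "column A i = {Min (column A i)..<Min (column A i) + int h}"
      using col j by blast
    \<comment> \<open>The row \<open>j\<close> shared with the next column lies above the bottom of
      column \<open>i\<close>, so this column has at least two cells.\<close>
    have "Min (column A i) + 1 \<le> j"
      unfolding Min[symmetric] using j fin by (intro Min_le) (auto simp: column_def)
    moreover have "j < Min (column A i) + int h"
      using j h by (auto simp: column_def)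
    ultimately have "2 \<le> h" by linarith
    then have "fib_heights (h # hs)"
      using hs by (cases hs) auto
    moreover have "{r \<in> A. i \<le> fst r} = {i} \<times> column A i \<union> {r \<in> A. i + 1 \<le> fst r}"
      by (auto simp: column_def order_le_less)
    then have "{r \<in> A. i \<le> fst r} = stair i (Min (column A i)) (h # hs)"
      using hs h Min by (simp add: stair.simps(2))
    ultimately show ?case by blast
  }
qed

lemma fibonacci_polyomino_iff:
  "fibonacci_polyomino A \<longleftrightarrow> (\<exists>a c hs. fib_heights hs \<and> A = stair a c hs)"
proof
  assume A: "fibonacci_polyomino A"
  then have fin: "finite (fst ` A)" "fst ` A \<noteq> {}"
    by (auto simp: fibonacci_polyomino_def polyomino_def)
  obtain p where p: "p \<in> A" "fst p = Min (fst ` A)"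
    using Min_in[OF fin] by force
  obtain q where q: "q \<in> A" "fst q = Max (fst ` A)"
    using Max_in[OF fin] by force
  have bounds: "fst p \<le> fst r \<and> fst r \<le> fst q" if "r \<in> A" for r
    using that fin p q by simp
  define d where "d = nat (fst q - fst p)"
  have d: "fst q = fst p + int d"
    using bounds[OF q(1)] by (simp add: d_def)
  have "\<exists>hs. fib_heights hs \<and> {r \<in> A. fst p \<le> fst r} = stair (fst p) (Min (column A (fst p))) hs"
    using fibonacci_polyomino_right_part[OF A p(1) refl q(1) d] bounds d by auto
  moreover have "{r \<in> A. fst p \<le> fst r} = A"
    using bounds by auto
  ultimately show "\<exists>a c hs. fib_heights hs \<and> A = stair a c hs"
    by metis
qed (auto intro: fibonacci_polyomino_stair)

subsection \<open>Translation classes\<close>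

lemma equiv_translation_rel: "equiv UNIV translation_rel"
proof (rule equivI)
  show "refl translation_rel"
    unfolding refl_on_def translation_rel_def
    by (auto intro!: exI[of _ "0::int"])
  show "sym translation_rel"
    unfolding sym_def translation_rel_def
  proof clarsimp
    fix A :: "cell set" and u v
    show "\<exists>u' v'. A = (\<lambda>(i, j). (i + u', j + v')) ` (\<lambda>(i, j). (i + u, j + v)) ` A"
      by (rule exI[of _ "-u"], rule exI[of _ "-v"]) (simp add: image_image case_prod_unfold)
  qed
  show "trans translation_rel"
    unfolding trans_def translation_rel_def
  proof clarsimp
    fix A :: "cell set" and u v u' v'
    show "\<exists>s t. (\<lambda>(i, j). (i + u', j + v')) ` (\<lambda>(i, j). (i + u, j + v)) ` A = (\<lambda>(i, j). (i + s, j + t)) ` A"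
      by (rule exI[of _ "u + u'"], rule exI[of _ "v + v'"])
        (simp add: image_image case_prod_unfold algebra_simps)
  qed
qed auto

lemma stair_translation_rel_iff:
  assumes "fib_heights hs" "fib_heights hs'"
  shows "(stair a c hs, stair a' c' hs') \<in> translation_rel \<longleftrightarrow> hs = hs'"
proof
  assume "(stair a c hs, stair a' c' hs') \<in> translation_rel"
  then show "hs = hs'"
    using stair_inject[OF assms(2,1)] by (auto simp: translation_rel_def translate_stair)
next
  assume "hs = hs'"
  then show "(stair a c hs, stair a' c' hs') \<in> translation_rel"
    unfolding translation_rel_def mem_Collect_eq case_prod_conv translate_stair
    by (intro exI[of _ "a' - a"] exI[of _ "c' - c"]) simp
qed

text \<open>Each translation class contains exactly one staircase with corner \<open>(0, 0)\<close>,
  and its height list is the same for the whole class.\<close>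

lemma fib_count_eq_card_heights:
  "fib_count m n = card {hs. fib_heights hs \<and> length hs = m \<and> ver_semi hs = n}"
proof -
  let ?H = "{hs. fib_heights hs \<and> length hs = m \<and> ver_semi hs = n}"
  let ?f = "\<lambda>hs. translation_rel `` {stair 0 0 hs}"
  have S: "{A. fibonacci_polyomino A \<and> hor_semiperimeter A = of_nat m \<and> ver_semiperimeter A = of_nat n}
     = {stair a c hs |a c hs. hs \<in> ?H}"
    by (auto simp: fibonacci_polyomino_iff hor_semiperimeter_stair ver_semiperimeter_stair) blast
  have cls: "translation_rel `` {stair a c hs} = ?f hs" if "hs \<in> ?H" for a c hs
    using that by (intro equiv_class_eq[OF equiv_translation_rel]) (simp add: stair_translation_rel_iff)
  have "bij_betw ?f ?H ({stair a c hs |a c hs. hs \<in> ?H} // translation_rel)"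
  proof (rule bij_betwI')
    fix hs hs' assume "hs \<in> ?H" "hs' \<in> ?H"
    then show "?f hs = ?f hs' \<longleftrightarrow> hs = hs'"
      using eq_equiv_class[OF _ equiv_translation_rel] stair_translation_rel_iff by blast
  next
    fix hs assume "hs \<in> ?H"
    then show "?f hs \<in> {stair a c hs |a c hs. hs \<in> ?H} // translation_rel"
      by (intro quotientI) blast
  next
    fix X assume "X \<in> {stair a c hs |a c hs. hs \<in> ?H} // translation_rel"
    then obtain a c hs where "hs \<in> ?H" "X = translation_rel `` {stair a c hs}"
      by (elim quotientE CollectE exE conjE) simp
    then show "\<exists>hs\<in>?H. X = ?f hs"
      using cls by blast
  qed
  then show ?thesis
    unfolding fib_count_def S by (rule bij_betw_same_card[symmetric])
qed

subsection \<open>Counting height lists by their first height\<close>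

definition height_seqs :: "nat \<Rightarrow> nat \<Rightarrow> nat \<Rightarrow> nat list set" where
  "height_seqs m k n = {hs. fib_heights hs \<and> length hs = m \<and> hd hs = k \<and> ver_semi hs = n}"

lemma height_seqs_0: "height_seqs 0 k n = {}"
  by (auto simp: height_seqs_def)

text \<open>This allows sums over all first heights to be cut off at any \<open>N\<close> with
  \<open>n \<le> N\<close>.\<close>

lemma height_seqs_first_le: "hs \<in> height_seqs m k n \<Longrightarrow> 1 \<le> k \<and> k \<le> n"
  using hd_le_ver_semi[of hs] fib_heights_hd_pos[of "hd hs" "tl hs"]
  by (cases hs) (auto simp: height_seqs_def)

lemma height_seqs_1: "1 \<le> k \<Longrightarrow> height_seqs (Suc 0) k n = (if k = n then {[k]} else {})"
  by (auto simp: height_seqs_def length_Suc_conv)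

text \<open>Only the last column may have height 1.\<close>

lemma height_seqs_first_1: "1 \<le> m \<Longrightarrow> height_seqs (Suc m) (Suc 0) n = {}"
proof -
  assume "1 \<le> m"
  have False if "fib_heights hs" "length hs = Suc m" "hd hs = Suc 0" for hs
    using that \<open>1 \<le> m\<close> by (cases hs rule: fib_heights.cases) auto
  then show ?thesis
    by (auto simp: height_seqs_def)
qed

text \<open>\<open>j\<close> is the second height. The condition
  \<open>max (k - j) 1 \<le> n\<close> guards the truncated subtraction, and the free bound
  \<open>N\<close> is later matched with the cut-off of the series recurrence.\<close>

lemma height_seqs_Suc:
  assumes "1 \<le> m" "2 \<le> k" "n \<le> N"
  shows "height_seqs (Suc m) k n =
    (\<Union>j\<in>{j\<in>{1..N}. max (k - j) 1 \<le> n}. Cons k ` height_seqs m j (n - max (k - j) 1))"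
proof (intro equalityI subsetI)
  fix hs assume hs: "hs \<in> height_seqs (Suc m) k n"
  then obtain j r where r: "hs = k # j # r"
    using assms by (cases hs rule: fib_heights.cases) (auto simp: height_seqs_def)
  have "j # r \<in> height_seqs m j (n - max (k - j) 1)" "max (k - j) 1 \<le> n"
    using hs r by (auto simp: height_seqs_def)
  moreover from this have "j \<in> {1..N}"
    using height_seqs_first_le[of "j # r" m j] assms by force
  ultimately show "hs \<in> (\<Union>j\<in>{j\<in>{1..N}. max (k - j) 1 \<le> n}. Cons k ` height_seqs m j (n - max (k - j) 1))"
    using r by blast
next
  fix hs assume "hs \<in> (\<Union>j\<in>{j\<in>{1..N}. max (k - j) 1 \<le> n}. Cons k ` height_seqs m j (n - max (k - j) 1))"
  then obtain j r where r: "max (k - j) 1 \<le> n" "hs = k # r" "r \<in> height_seqs m j (n - max (k - j) 1)"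
    by blast
  then show "hs \<in> height_seqs (Suc m) k n"
    using assms by (cases r) (auto simp: height_seqs_def)
qed

lemma finite_height_seqs: "finite (height_seqs m k n)"
proof (induction m arbitrary: k n)
  case (Suc m)
  consider "m = 0 \<or> k = 0" | "1 \<le> m" "k = 1" | "1 \<le> m" "2 \<le> k" by linarith
  then show ?case
  proof cases
    case 1
    have "height_seqs (Suc m) 0 n = {}"
      using height_seqs_first_le by fastforce
    with 1 show ?thesis
      by (cases "k = 0") (auto simp: height_seqs_1)
  next
    case 2
    then show ?thesis by (simp add: height_seqs_first_1)
  next
    case 3
    show ?thesis
      unfolding height_seqs_Suc[OF 3 order_refl] using Suc.IH by auto
  qed
qed (simp add: height_seqs_0)

lemma card_height_seqs_Suc:
  assumes "1 \<le> m" "2 \<le> k" "n \<le> N"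
  shows "card (height_seqs (Suc m) k n) =
    (\<Sum>j=1..N. if max (k - j) 1 \<le> n then card (height_seqs m j (n - max (k - j) 1)) else 0)"
proof -
  have "card (height_seqs (Suc m) k n) =
      (\<Sum>j\<in>{j\<in>{1..N}. max (k - j) 1 \<le> n}. card (Cons k ` height_seqs m j (n - max (k - j) 1)))"
    unfolding height_seqs_Suc[OF assms]
    by (rule card_UN_disjoint) (auto simp: finite_height_seqs, auto simp: height_seqs_def)
  also have "\<dots> = (\<Sum>j\<in>{j\<in>{1..N}. max (k - j) 1 \<le> n}. card (height_seqs m j (n - max (k - j) 1)))"
    by (simp add: card_image)
  finally show ?thesis
    by (simp only: sum.inter_filter finite_atLeastAtMost)
qed

lemma fib_count_eq_sum:
  assumes "n \<le> N"
  shows "fib_count m n = (\<Sum>k=1..N. card (height_seqs m k n))"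
proof -
  have "{hs. fib_heights hs \<and> length hs = m \<and> ver_semi hs = n} = (\<Union>k\<in>{1..N}. height_seqs m k n)"
  proof (intro equalityI subsetI)
    fix hs assume "hs \<in> {hs. fib_heights hs \<and> length hs = m \<and> ver_semi hs = n}"
    then have "hs \<in> height_seqs m (hd hs) n"
      by (simp add: height_seqs_def)
    then show "hs \<in> (\<Union>k\<in>{1..N}. height_seqs m k n)"
      using height_seqs_first_le[of hs] assms by fastforce
  qed (auto simp: height_seqs_def)
  then show ?thesis
    unfolding fib_count_eq_card_heights
    by (simp only:) (rule card_UN_disjoint, auto simp: finite_height_seqs, auto simp: height_seqs_def)
qed

subsection \<open>The generating function\<close>

text \<open>Keeps \<open>var_y\<close>, which is a constant of the outer series ring, from being merged into
  other constants.\<close>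

declare fps_const_add [simp del] fps_const_sub [simp del] fps_const_mult [simp del]
  fps_const_neg [simp del] fps_const_power [simp del]

lemma var_y_power_mult_nth: "(F * var_y ^ p) $ m $ n = (if n < p then 0 else F $ m $ (n - p))"
  by (simp add: fps_const_power fps_X_power_mult_right_nth)

text \<open>Invertibility in the outer ring reduces to that of \<open>F $ 0\<close>, a series over a
  field with constant term 1.\<close>

lemma fps2_unit_if_constant_term_1:
  fixes F :: fps2
  assumes "F $ 0 $ 0 = 1"
  shows "\<exists>G. F * G = 1"
proof -
  have "F $ 0 * inverse (F $ 0) = 1"
    using assms by (simp add: inverse_mult_eq_1')
  then show ?thesis
    using fps_right_inverse by blast
qed

text \<open>Modulo \<open>var_y\<close> the kernel equation reads \<open>(1 - b) * b = 0\<close>,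
  and \<open>1 - b\<close> is a unit.\<close>

lemma root_of_kernel_dvd:
  fixes b :: fps2
  assumes "(1 - b) * (b - var_y) = var_x * var_y * (1 - var_y)" "b $ 0 $ 0 = 0"
  shows "var_y dvd b"
proof -
  obtain G where G: "(1 - b) * G = 1"
    using fps2_unit_if_constant_term_1[of "1 - b"] assms(2) by auto
  have "b = ((1 - b) * G) * b"
    by (simp add: G)
  also have "\<dots> = G * ((1 - b) * (b - var_y) + var_y * (1 - b))"
    by (simp add: algebra_simps)
  also have "\<dots> = var_y * (G * (var_x * (1 - var_y) + (1 - b)))"
    unfolding assms(1) by (simp add: algebra_simps)
  finally show ?thesis
    by (rule dvdI)
qed

text \<open>The factor \<open>1 - b\<close> normalises the geometric series so that the terms with
  \<open>k \<ge> 2\<close> add up to \<open>e\<close>. The value at 0 is a dummy; sums start at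
  1.\<close>

definition first_height_gf :: "fps2 \<Rightarrow> fps2 \<Rightarrow> nat \<Rightarrow> fps2" where
  "first_height_gf b e k = (if k \<le> 1 then var_x * var_y else e * (1 - b) * b ^ (k - 2))"

text \<open>Collects what the counting needs about \<open>b\<close> and \<open>e\<close>, without
  the square root. The second assumption is the recurrence for first height 2, multiplied out; the
  divisibilities settle the coefficients with \<open>m = 0\<close> or \<open>n = 0\<close>.\<close>

locale kernel_root =
  fixes b e :: fps2
  assumes kernel: "(1 - b) * (b - var_y) = var_x * var_y * (1 - var_y)"
    and e: "e * (1 - b - var_x * var_y) = var_x * var_y\<^sup>2 * (1 + var_x)"
    and b00: "b $ 0 $ 0 = 0"
    and x_dvd_e: "var_x dvd e"
    and y_dvd_e: "var_y dvd e"
begin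

section \<open>Geometric solution of the recurrence\<close>

abbreviation g where "g \<equiv> first_height_gf b e"

text \<open>The sum telescopes; keeping the remainder \<open>e * b ^ (N - 1)\<close> avoids infinite
  sums.\<close>

lemma sum_g: "1 \<le> N \<Longrightarrow> (\<Sum>k=1..N. g k) + e * b ^ (N - 1) = var_x * var_y + e"
proof (induction N rule: nat_induct_at_least)
  case (Suc N)
  then obtain M where "N = Suc M" by (cases N) auto
  with Suc show ?case
    by (simp add: first_height_gf_def algebra_simps)
qed (simp add: first_height_gf_def)

lemma e_alt: "e * (1 - b) = var_x * var_y * (var_y + var_x * var_y + e)"
  using e by (simp add: algebra_simps power2_eq_square)

text \<open>First heights \<open>j \<ge> k + 2\<close> all carry the exponent 1, and their geometric
  tail is \<open>e * b ^ k\<close>.\<close>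

lemma g_recurrence_upto:
  "g (k + 2) = var_x * var_y ^ (k + 2) +
     var_x * ((\<Sum>j=1..k+1. g j * var_y ^ (k + 2 - j)) + var_y * e * b ^ k)"
proof (induction k)
  case 0
  show ?case
    using e_alt by (simp add: first_height_gf_def algebra_simps power2_eq_square)
next
  case (Suc k)
  have "(\<Sum>j=1..k+1. g j * var_y ^ (Suc k + 2 - j)) = var_y * (\<Sum>j=1..k+1. g j * var_y ^ (k + 2 - j))"
    unfolding sum_distrib_left
  proof (rule sum.cong)
    fix j assume "j \<in> {1..k+1}"
    then have "Suc k + 2 - j = Suc (k + 2 - j)" by auto
    then show "g j * var_y ^ (Suc k + 2 - j) = var_y * (g j * var_y ^ (k + 2 - j))"
      by (simp add: algebra_simps)
  qed simp
  then have sum: "(\<Sum>j=1..Suc k+1. g j * var_y ^ (Suc k + 2 - j)) =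
      var_y * (\<Sum>j=1..k+1. g j * var_y ^ (k + 2 - j)) + g (k + 2) * var_y"
    by simp
  have "g (Suc k + 2) = e * b ^ k * ((1 - b) * (b - var_y)) + var_y * g (k + 2)"
    by (simp add: first_height_gf_def algebra_simps)
  \<comment> \<open>After the kernel equation, \<open>var_y * e * b ^ k\<close> is split into its
    first term \<open>g (k + 2) * var_y\<close> and the shorter tail.\<close>
  also have "e * b ^ k * ((1 - b) * (b - var_y)) = var_x * (g (k + 2) * var_y + var_y * e * b ^ Suc k - var_y * var_y * e * b ^ k)"
    unfolding kernel by (simp add: first_height_gf_def algebra_simps)
  \<comment> \<open>Only the second \<open>g (k + 2)\<close> is expanded; the first is the new
    summand \<open>j = k + 2\<close>.\<close>
  finally show ?case
    unfolding sum by (subst (asm) (2) Suc.IH) (simp add: algebra_simps)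
qed

text \<open>Moves terms one by one from the geometric tail into the sum, so the cut-off can be taken
  as large as desired.\<close>

lemma g_recurrence:
  assumes "2 \<le> k" "k \<le> Suc N"
  shows "g k = var_x * var_y ^ k +
     var_x * ((\<Sum>j=1..N. g j * var_y ^ max (k - j) 1) + var_y * e * b ^ (N - 1))"
proof -
  have "k - 1 \<le> N" using assms by simp
  then show ?thesis
  proof (induction N rule: nat_induct_at_least)
    case base
    obtain l where k: "k = l + 2"
      using assms by (metis add.commute le_Suc_ex)
    have "(\<Sum>j=1..l+1. g j * var_y ^ max (k - j) 1) = (\<Sum>j=1..l+1. g j * var_y ^ (l + 2 - j))"
    proof (rule sum.cong)
      fix j assume "j \<in> {1..l+1}"
      then have "max (k - j) 1 = l + 2 - j"
        unfolding k by auto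
      then show "g j * var_y ^ max (k - j) 1 = g j * var_y ^ (l + 2 - j)"
        by simp
    qed simp
    then show ?case
      using g_recurrence_upto[of l] by (simp add: k)
  next
    case (Suc N)
    then obtain M where M: "N = Suc M"
      using assms by (cases N) auto
    have "max (k - Suc N) 1 = 1"
      using Suc.hyps by simp
    then have "(\<Sum>j=1..Suc N. g j * var_y ^ max (k - j) 1) =
        (\<Sum>j=1..N. g j * var_y ^ max (k - j) 1) + g (Suc N) * var_y"
      by simp
    moreover have "g (Suc N) * var_y + var_y * e * b ^ (Suc N - 1) = var_y * e * b ^ (N - 1)"
      unfolding M by (simp add: first_height_gf_def algebra_simps)
    ultimately show ?case
      using Suc.IH by (simp only: add.assoc)
  qed
qed

text \<open>\<open>b ^ p\<close> is a multiple of \<open>var_y ^ p\<close>; hence the remainders do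
  not reach low powers of y.\<close>

lemma b_power_mult_nth: "n < p \<Longrightarrow> (F * b ^ p) $ m $ n = 0"
proof -
  assume "n < p"
  obtain \<beta> where "b = var_y * \<beta>"
    using root_of_kernel_dvd[OF kernel b00] by (rule dvdE)
  then have "F * b ^ p = (F * \<beta> ^ p) * var_y ^ p"
    by (simp add: power_mult_distrib mult_ac)
  then show ?thesis
    using \<open>n < p\<close> by (simp only: var_y_power_mult_nth if_True)
qed

section \<open>Comparison of coefficients with the counts\<close>

lemma e_nth_0: "e $ 0 = 0"
  using x_dvd_e by (auto elim: dvdE)

lemma e_nth_nth_0: "e $ m $ 0 = 0"
  using y_dvd_e by (auto elim: dvdE)

lemma g_nth_0: "g k $ 0 = 0"
  by (simp add: first_height_gf_def e_nth_0 fps_mult_nth_0)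

text \<open>Both sides obey the same recurrence, and its factor \<open>var_x\<close> expresses the
  coefficient at \<open>Suc m\<close> through those at \<open>m\<close>.\<close>

lemma card_height_seqs: "1 \<le> k \<Longrightarrow> of_nat (card (height_seqs m k n)) = g k $ m $ n"
proof (induction m arbitrary: k n)
  case 0
  show ?case
    by (simp add: height_seqs_0 g_nth_0)
next
  case (Suc m)
  show ?case
  proof (cases "k = 1")
    case True
    show ?thesis
    proof (cases "m = 0")
      case True
      with \<open>k = 1\<close> show ?thesis
        by (auto simp: height_seqs_1 first_height_gf_def)
    next
      case False
      with \<open>k = 1\<close> show ?thesis
        by (simp add: height_seqs_first_1 first_height_gf_def)
    qed
  next
    case False
    then have k: "2 \<le> k" using Suc.prems by simp
    \<comment> \<open>Large enough to include \<open>k\<close> and to make the remainder vanish at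
      \<open>n\<close>.\<close>
    define N where "N = n + k + 2"
    have N: "k \<le> Suc N" "n \<le> N" "n < N - 1"
      by (auto simp: N_def)
    have y: "(var_x * var_y ^ k) $ Suc m $ n = (if m = 0 \<and> n = k then 1 else 0)"
      by (simp add: fps_const_power)
    have sum: "(\<Sum>j=1..N. g j * var_y ^ max (k - j) 1) $ m $ n =
        (\<Sum>j=1..N. if max (k - j) 1 \<le> n then g j $ m $ (n - max (k - j) 1) else 0)"
      unfolding fps_sum_nth var_y_power_mult_nth by (rule sum.cong) auto
    have g: "g k $ Suc m $ n = (if m = 0 \<and> n = k then 1 else 0) +
        (\<Sum>j=1..N. if max (k - j) 1 \<le> n then g j $ m $ (n - max (k - j) 1) else 0)"
      unfolding g_recurrence[OF k N(1)] fps_add_nth y sum[symmetric]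
      using b_power_mult_nth[OF N(3), of "var_y * e" m] by simp
    show ?thesis
    proof (cases "m = 0")
      case True
      then have "(\<Sum>j=1..N. if max (k - j) 1 \<le> n then g j $ m $ (n - max (k - j) 1) else 0) = 0"
        by (intro sum.neutral) (simp add: g_nth_0)
      with True show ?thesis
        unfolding g using Suc.prems by (simp add: height_seqs_1)
    next
      case False
      then show ?thesis
        unfolding g using card_height_seqs_Suc[of m k n N] k N Suc.IH
        by (auto intro!: sum.cong)
    qed
  qed
qed

lemma fib_gf_eq: "fib_gf = var_x * var_y + e"
proof (intro fps_ext)
  fix m n
  show "fib_gf $ m $ n = (var_x * var_y + e) $ m $ n"
  proof (cases "1 \<le> m \<and> 1 \<le> n")
    case True
    have "(e * b ^ Suc n) $ m $ n = 0"
      by (rule b_power_mult_nth) simp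
    then have "(var_x * var_y + e) $ m $ n = (\<Sum>k=1..n+2. g k $ m $ n)"
      using sum_g[of "n + 2"] by (simp add: fps_sum_nth flip: sum_g[of "n + 2"])
    also have "\<dots> = (\<Sum>k=1..n+2. of_nat (card (height_seqs m k n)))"
      by (rule sum.cong) (simp_all add: card_height_seqs)
    also have "\<dots> = of_nat (fib_count m n)"
      by (subst fib_count_eq_sum[of n "n + 2"]) simp_all
    finally show ?thesis
      using True by (simp add: fib_gf_def)
  next
    case False
    then have "m = 0 \<or> n = 0" by linarith
    then show ?thesis
      by (auto simp: fib_gf_def e_nth_0 e_nth_nth_0)
  qed
qed

text \<open>Eliminates \<open>e\<close> by comparing both sides after multiplication by
  \<open>?u\<close>, where the kernel equation gives
  \<open>(b - var_y - var_x * var_y) * ?u = (var_x * var_y)\<^sup>2\<close>; then the nonzero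
  \<open>?u\<close> is cancelled.\<close>

lemma x_times_gf: "var_x * (var_x * var_y + e) = (1 + var_x) * b - var_y - 2 * var_x * var_y"
proof -
  let ?u = "1 - b - var_x * var_y"
  have "(b - var_y - var_x * var_y) * ?u =
      (1 - b) * (b - var_y) - var_x * var_y * (1 - var_y) + (var_x * var_y)\<^sup>2"
    by (simp add: algebra_simps power2_eq_square)
  then have "(b - var_y - var_x * var_y) * ?u = (var_x * var_y)\<^sup>2"
    unfolding kernel by simp
  moreover have "var_x * e * ?u = (1 + var_x) * (var_x * var_y)\<^sup>2"
    unfolding mult.assoc e by (simp add: algebra_simps power2_eq_square)
  ultimately have "var_x * e * ?u = (1 + var_x) * (b - var_y - var_x * var_y) * ?u"
    by (simp add: mult.assoc)
  moreover have "?u $ 0 $ 0 = 1"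
    using b00 by simp
  then have "?u \<noteq> 0"
    by (metis fps_zero_nth zero_neq_one)
  ultimately have "var_x * e = (1 + var_x) * (b - var_y - var_x * var_y)"
    by (metis mult_right_cancel)
  then show ?thesis
    by (simp add: algebra_simps)
qed

end

section \<open>Solving the kernel equation by the square root\<close>

theorem theorem2p6:
  shows "let N = 1 + var_x - var_y - 3 * var_x * var_y
               - (1 + var_x) * fps2_sqrt ((1 - var_y) * (1 - var_y - 4 * var_x * var_y))
         in 2 * var_x dvd N \<and> fib_gf = N / (2 * var_x)"
proof -
  define F :: fps2 where "F = (1 - var_y) * (1 - var_y - 4 * var_x * var_y)"
  define S where "S = fps2_sqrt F"
  \<comment> \<open>The quadratic formula for the kernel equation; the minus sign selects the root
    without constant term.\<close>
  define b :: fps2 where "b = fps_const (fps_const (1 / 2)) * (1 + var_y - S)"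
  have "F $ 0 $ 0 = 1"
    by (simp add: F_def)
  then have S: "S\<^sup>2 = F" "S $ 0 $ 0 = 1"
    unfolding S_def by (rule fps2_sqrt)+
  have half: "2 * fps_const (fps_const (1 / 2)) = (1 :: fps2)"
    by (simp add: numeral_fps_const fps_const_mult)
  have "2 * b = 1 + var_y - S"
    unfolding b_def mult.assoc[symmetric] half by simp
  then have S_eq: "S = 1 + var_y - 2 * b"
    by simp
  have b00: "b $ 0 $ 0 = 0"
    using S(2) by (simp add: b_def)
  \<comment> \<open>Both sides equal \<open>(1 - var_y)\<^sup>2 - F\<close>; the factor 4 clears the
    halves.\<close>
  have "4 * ((1 - b) * (b - var_y)) = 4 * (var_x * var_y * (1 - var_y))"
    using S(1) unfolding S_eq F_def by (simp add: algebra_simps power2_eq_square)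
  then have kernel: "(1 - b) * (b - var_y) = var_x * var_y * (1 - var_y)"
    by simp
  obtain G where G: "(1 - b - var_x * var_y) * G = 1"
    using fps2_unit_if_constant_term_1[of "1 - b - var_x * var_y"] b00 by auto
  define e where "e = var_x * var_y\<^sup>2 * (1 + var_x) * G"
  interpret kernel_root b e
  proof
    have "e * (1 - b - var_x * var_y) =
        var_x * var_y\<^sup>2 * (1 + var_x) * ((1 - b - var_x * var_y) * G)"
      unfolding e_def by (simp only: mult_ac)
    then show "e * (1 - b - var_x * var_y) = var_x * var_y\<^sup>2 * (1 + var_x)"
      unfolding G by simp
    show "var_x dvd e" "var_y dvd e"
      by (auto simp: e_def power2_eq_square)
  qed (fact kernel b00)+
  \<comment> \<open>In terms of \<open>b\<close> the numerator is twice the right side of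
    \<open>x_times_gf\<close>.\<close>
  have N: "1 + var_x - var_y - 3 * var_x * var_y - (1 + var_x) * S = 2 * var_x * fib_gf"
    unfolding fib_gf_eq mult.assoc x_times_gf S_eq by (simp add: algebra_simps)
  show ?thesis
    unfolding Let_def F_def[symmetric] S_def[symmetric] N
    by (simp only: fps2_divide_2x) simp
qed

end
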